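(* Let $s:[1,\infty)\to\mathbb{R}$ be a function with $s\in L_{\rm loc}[1,\infty)$, and suppose that $s$ is summable $(L,1)$ to some $A\in\mathbb{R}$. Then the ordinary limit $\lim_{t\to\infty}s(t)=A$ exists if and only if both $$\limsup_{\lambda\to 1+}\ \liminf_{t\to\infty}\ \frac{1}{(\lambda-1)\log t}\int_t^{t^\lambda}\frac{s(u)-s(t)}{u}\,du\ \ge 0$$ and $$\limsup_{\lambda\to 1-}\ \liminf_{t\to\infty}\ \frac{1}{(1-\lambda)\log t}\int_{t^\lambda}^{t}\frac{s(t)-s(u)}{u}\,du\ \ge 0.$$
   Context: $L_{\rm loc}[1,\infty)$ denotes the set of functions on $[1,\infty)$ that are Lebesgue integrable on every bounded interval $[1,t]$, $t>1$. A function $s\in L_{\rm loc}[1,\infty)$ is an actual (everywhere defined) function. It is called summable $(L,1)$ to $A$ if $\lim_{t\to\infty}\tau(t)=A$, where $\tau(t):=\frac{1}{\log t}\int_1^t\frac{s(u)}{u}\,du$ for $t>1$, with $\log$ the natural logarithm. *)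

theory Defs
  imports "HOL-Analysis.Analysis"
begin

text \<open>A function on \<open>[1,\<infinity>)\<close> is represented by a total function on the reals; only its values on
  \<open>[1,\<infinity>)\<close> enter the definitions below. Integrals are taken with respect to \<^const>\<open>lebesgue\<close>
  rather than \<^const>\<open>lborel\<close>, so that Lebesgue measurable functions which are not Borel measurable
  are covered.\<close>

definition L_loc :: "(real \<Rightarrow> real) set" where
  "L_loc = {s. \<forall>t>1. set_integrable lebesgue {1..t} s}"

definition log_mean :: "(real \<Rightarrow> real) \<Rightarrow> real \<Rightarrow> real" where
  "log_mean s t = (1 / ln t) * (LINT u:{1..t}|lebesgue. s u / u)"

definition summable_L1 :: "(real \<Rightarrow> real) \<Rightarrow> real \<Rightarrow> bool" where
  "summable_L1 s A \<longleftrightarrow> (log_mean s \<longlongrightarrow> A) at_top"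

end

theory Submission
  imports Defs "HOL-Real_Asymp.Real_Asymp"
begin

text \<open>Let \<open>\<tau>\<close> be the logarithmic mean of \<open>s\<close>. The average of \<open>s\<close> between \<open>t\<close> and \<open>t\<^sup>l\<close> with respect
  to \<open>du/u\<close> equals \<open>(l \<tau>(t\<^sup>l) - \<tau>(t)) / (l - 1)\<close>, so for every fixed \<open>l \<noteq> 1\<close> it tends to \<open>A\<close>. The two
  expressions in the theorem are therefore \<open>A - s(t) + o(1)\<close> and \<open>s(t) - A + o(1)\<close>: they tend to \<open>0\<close>
  if \<open>s\<close> converges, and the two conditions bound \<open>s(t)\<close> eventually by \<open>A + \<epsilon>\<close> from above and by
  \<open>A - \<epsilon>\<close> from below.\<close>

lemma L_loc_const: "(\<lambda>_. c) \<in> L_loc"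
  by (simp add: L_loc_def absolutely_integrable_on_const)

text \<open>For \<open>1 \<le> a\<close> the factor \<open>1 / u\<close> is at most 1 on the
  interval, so the quotient is dominated by \<open>s\<close>.\<close>

lemma L_loc_integrable_divide:
  assumes "s \<in> L_loc" "1 \<le> a"
  shows "set_integrable lebesgue {a..b} (\<lambda>u. s u / u)"
proof -
  \<comment> \<open>\<open>L_loc\<close> speaks only of right end points above 1, whereas
    \<open>b\<close> is arbitrary; hence \<open>max b 2\<close>.\<close>
  have "set_integrable lebesgue {1..max b 2} s"
    using assms by (simp add: L_loc_def)
  then have s: "set_integrable lebesgue {a..b} s"
    by (rule set_integrable_subset) (use assms in auto)
  have [measurable]: "(\<lambda>u::real. 1 / u) \<in> borel_measurable lebesgue"
    by (intro measurable_completion) measurable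
  have "set_integrable lebesgue {a..b} (\<lambda>u. 1 / u * s u)"
    unfolding set_integrable_def
  proof (rule Bochner_Integration.integrable_bound)
    show "integrable lebesgue (\<lambda>u. indicator {a..b} u *\<^sub>R s u)"
      using s by (simp add: set_integrable_def)
    from this have [measurable]: "(\<lambda>u. indicator {a..b} u *\<^sub>R s u) \<in> borel_measurable lebesgue"
      by (rule borel_measurable_integrable)
    \<comment> \<open>The indicator stays attached to \<open>s\<close>: only this product is known
      to be measurable, as \<open>s\<close> is arbitrary off
      \<open>[1, \<infinity>)\<close>.\<close>
    have "(\<lambda>u. 1 / u * (indicator {a..b} u *\<^sub>R s u)) \<in> borel_measurable lebesgue"
      by measurable
    then show "(\<lambda>u. indicator {a..b} u *\<^sub>R (1 / u * s u)) \<in> borel_measurable lebesgue"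
      by (simp add: mult.left_commute)
    show "AE u in lebesgue. norm (indicator {a..b} u *\<^sub>R (1 / u * s u))
            \<le> norm (indicator {a..b} u *\<^sub>R s u)"
    proof (rule AE_I2)
      fix u :: real
      have "\<bar>s u\<bar> \<le> \<bar>s u\<bar> * u" if "a \<le> u"
        using that assms(2) by (simp add: mult_le_cancel_left1)
      then show "norm (indicator {a..b} u *\<^sub>R (1 / u * s u)) \<le> norm (indicator {a..b} u *\<^sub>R s u)"
        using assms(2) by (auto simp: indicator_def divide_simps abs_mult)
    qed
  qed
  then show ?thesis by simp
qed

lemma set_integral_const_divide:
  fixes c :: real
  assumes "1 \<le> a" "a \<le> b"
  shows "(LINT u:{a..b}|lebesgue. c / u) = c * (ln b - ln a)"
proof -
  have "((\<lambda>u. c / u) has_integral c * ln b - c * ln a) {a..b}"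
    by (rule fundamental_theorem_of_calculus)
       (use assms in \<open>auto intro!: derivative_eq_intros
          simp: has_real_derivative_iff_has_vector_derivative[symmetric]\<close>)
  then show ?thesis
    using set_lebesgue_integral_eq_integral(2)
            [OF L_loc_integrable_divide[OF L_loc_const assms(1), of b c]]
    by (simp add: integral_unique right_diff_distrib)
qed

text \<open>The factor \<open>ln b\<close> undoes the normalisation of \<open>log_mean\<close>,
  which leaves the integral over \<open>{1..b}\<close>; likewise for \<open>a\<close>. The rest is
  additivity of the integral over adjacent intervals.\<close>

lemma set_integral_divide_eq_log_mean:
  assumes s: "s \<in> L_loc" and ab: "1 < a" "a \<le> b"
  shows "(LINT u:{a..b}|lebesgue. s u / u) = ln b * log_mean s b - ln a * log_mean s a"
proof -
  note int = L_loc_integrable_divide[OF s]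
  have "integral {1..a} (\<lambda>u. s u / u) + integral {a..b} (\<lambda>u. s u / u)
      = integral {1..b} (\<lambda>u. s u / u)"
    by (rule Henstock_Kurzweil_Integration.integral_combine)
       (use ab int[of 1 b] set_lebesgue_integral_eq_integral(1) in auto)
  then show ?thesis
    using ab by (simp add: log_mean_def set_lebesgue_integral_eq_integral(2)[OF int])
qed

text \<open>One formula serves both sides of 1: for \<open>l < 1\<close> the end points swap, and
  numerator and denominator change sign together.\<close>

definition log_avg :: "(real \<Rightarrow> real) \<Rightarrow> real \<Rightarrow> real \<Rightarrow> real" where
  "log_avg s l t = (l * log_mean s (t powr l) - log_mean s t) / (l - 1)"

text \<open>As \<open>0 < l\<close>, also \<open>t powr l\<close> tends to infinity, so both means
  in the numerator tend to \<open>A\<close>.\<close>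

lemma log_avg_tendsto:
  assumes "summable_L1 s A" "0 < l" "l \<noteq> 1"
  shows "(log_avg s l \<longlongrightarrow> A) at_top"
proof -
  have \<tau>: "(log_mean s \<longlongrightarrow> A) at_top"
    using assms(1) by (simp add: summable_L1_def)
  have "filterlim (\<lambda>t::real. t powr l) at_top at_top"
    using assms(2) by real_asymp
  then have "((\<lambda>t. log_mean s (t powr l)) \<longlongrightarrow> A) at_top"
    by (rule filterlim_compose[OF \<tau>])
  then have "(log_avg s l \<longlongrightarrow> (l * A - A) / (l - 1)) at_top"
    unfolding log_avg_def using assms(3) by (intro tendsto_intros \<tau>) auto
  moreover have "(l * A - A) / (l - 1) = A"
    using assms(3) by (simp add: field_simps)
  ultimately show ?thesis by simp
qed

text \<open>The interval has length \<open>(l - 1) * ln t\<close> with respect to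
  \<open>du/u\<close>, so after division the constant \<open>s t\<close> contributes exactly
  itself.\<close>

lemma forward_mean_eq:
  assumes s: "s \<in> L_loc" and "1 < l" "1 < t"
  shows "1 / ((l - 1) * ln t) * (LINT u:{t..t powr l}|lebesgue. (s u - s t) / u)
       = log_avg s l t - s t"
proof -
  have le: "t \<le> t powr l"
    using assms powr_mono[of 1 l t] by simp
  have "(LINT u:{t..t powr l}|lebesgue. (s u - s t) / u)
      = (LINT u:{t..t powr l}|lebesgue. s u / u) - (LINT u:{t..t powr l}|lebesgue. s t / u)"
    unfolding diff_divide_distrib
    by (rule set_integral_diff) (use assms in \<open>auto intro!: L_loc_integrable_divide L_loc_const\<close>)
  also have "\<dots> = ln t * (l * log_mean s (t powr l) - log_mean s t) - s t * ((l - 1) * ln t)"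
    using assms le
    by (simp add: set_integral_divide_eq_log_mean set_integral_const_divide ln_powr algebra_simps)
  also have "\<dots> = (l - 1) * ln t * (log_avg s l t - s t)"
  proof -
    have "l * log_mean s (t powr l) - log_mean s t = (l - 1) * log_avg s l t"
      using assms by (simp add: log_avg_def)
    then show ?thesis by (simp only:) (simp add: algebra_simps)
  qed
  finally show ?thesis
    using assms by simp
qed

lemma backward_mean_eq:
  assumes s: "s \<in> L_loc" and "0 < l" "l < 1" "1 < t"
  shows "1 / ((1 - l) * ln t) * (LINT u:{t powr l..t}|lebesgue. (s t - s u) / u)
       = s t - log_avg s l t"
proof -
  \<comment> \<open>Positivity of \<open>l\<close> keeps the lower end point above 1, where the
    integral formulas apply.\<close>
  have le: "t powr l \<le> t" and gt: "1 < t powr l"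
    using assms powr_mono[of l 1 t] by simp_all
  have "(LINT u:{t powr l..t}|lebesgue. (s t - s u) / u)
      = (LINT u:{t powr l..t}|lebesgue. s t / u) - (LINT u:{t powr l..t}|lebesgue. s u / u)"
    unfolding diff_divide_distrib
    by (rule set_integral_diff) (use assms less_imp_le[OF gt] in \<open>auto intro!: L_loc_integrable_divide L_loc_const\<close>)
  also have "\<dots> = s t * ((1 - l) * ln t) - ln t * (log_mean s t - l * log_mean s (t powr l))"
    using assms le gt
    by (simp add: set_integral_divide_eq_log_mean set_integral_const_divide ln_powr algebra_simps)
  also have "\<dots> = (1 - l) * ln t * (s t - log_avg s l t)"
  proof -
    have "log_mean s t - l * log_mean s (t powr l) = (1 - l) * log_avg s l t"
      using assms by (simp add: log_avg_def divide_simps) (simp add: algebra_simps)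
    then show ?thesis by (simp only:) (simp add: algebra_simps)
  qed
  finally show ?thesis
    using assms by simp
qed

text \<open>Serves the direction from convergence to the two conditions. Convergence for each single
  \<open>l\<close> is enough, without uniformity in \<open>l\<close>, since the inner limit is taken
  first.\<close>

lemma Limsup_Liminf_eq_0:
  fixes f :: "'a \<Rightarrow> 'b \<Rightarrow> real"
  assumes "F \<noteq> bot" "G \<noteq> bot" "\<forall>\<^sub>F l in F. (f l \<longlongrightarrow> 0) G"
  shows "Limsup F (\<lambda>l. Liminf G (\<lambda>t. ereal (f l t))) = 0"
proof -
  have "Liminf G (\<lambda>t. ereal (f l t)) = 0" if "(f l \<longlongrightarrow> 0) G" for l
    using lim_imp_Liminf[OF assms(2) tendsto_ereal[OF that]] by simp
  with assms(3) have "\<forall>\<^sub>F l in F. Liminf G (\<lambda>t. ereal (f l t)) = 0"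
    by (rule eventually_mono)
  then have "Limsup F (\<lambda>l. Liminf G (\<lambda>t. ereal (f l t))) = Limsup F (\<lambda>_. 0)"
    by (rule Limsup_eq)
  then show ?thesis
    using assms(1) by (simp add: Limsup_const)
qed

text \<open>Serves the converse direction, where one good \<open>l\<close> on the correct side of 1
  is enough; \<open>P\<close> records that side. If no such \<open>l\<close> existed, the outer
  limit would be at most \<open>- e\<close>.\<close>

lemma Limsup_Liminf_nonneg_obtains:
  fixes f :: "'a \<Rightarrow> 'b \<Rightarrow> real"
  assumes "Limsup F (\<lambda>l. Liminf G (\<lambda>t. ereal (f l t))) \<ge> 0" "\<forall>\<^sub>F l in F. P l" "0 < e"
  obtains l where "P l" "\<forall>\<^sub>F t in G. - e < f l t"
proof -
  have "\<not> (\<forall>\<^sub>F l in F. P l \<longrightarrow> Liminf G (\<lambda>t. ereal (f l t)) \<le> ereal (- e))"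
  proof
    assume "\<forall>\<^sub>F l in F. P l \<longrightarrow> Liminf G (\<lambda>t. ereal (f l t)) \<le> ereal (- e)"
    with assms(2) have "\<forall>\<^sub>F l in F. Liminf G (\<lambda>t. ereal (f l t)) \<le> ereal (- e)"
      by eventually_elim simp
    then have "Limsup F (\<lambda>l. Liminf G (\<lambda>t. ereal (f l t))) \<le> ereal (- e)"
      by (rule Limsup_bounded)
    with assms(1) have "0 \<le> ereal (- e)"
      by (rule order_trans)
    with assms(3) show False by simp
  qed
  then obtain l where l: "P l" "ereal (- e) < Liminf G (\<lambda>t. ereal (f l t))"
    by (auto simp: not_eventually dest!: frequently_ex)
  from less_LiminfD[OF l(2)] have "\<forall>\<^sub>F t in G. - e < f l t" by simp
  with l(1) show thesis by (rule that)
qed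

theorem theorem1:
  fixes s :: "real \<Rightarrow> real" and A :: real
  assumes "s \<in> L_loc"
    and "summable_L1 s A"
  shows "(s \<longlongrightarrow> A) at_top \<longleftrightarrow>
     Limsup (at_right 1) (\<lambda>l::real. Liminf at_top (\<lambda>t::real.
        ereal (1 / ((l - 1) * ln t) * (LINT u:{t..t powr l}|lebesgue. (s u - s t) / u)))) \<ge> 0
   \<and> Limsup (at_left 1) (\<lambda>l::real. Liminf at_top (\<lambda>t::real.
        ereal (1 / ((1 - l) * ln t) * (LINT u:{t powr l..t}|lebesgue. (s t - s u) / u)))) \<ge> 0"
proof -
  define f where "f l t = 1 / ((l - 1) * ln t) * (LINT u:{t..t powr l}|lebesgue. (s u - s t) / u)"
    for l t :: real
  define g where "g l t = 1 / ((1 - l) * ln t) * (LINT u:{t powr l..t}|lebesgue. (s t - s u) / u)"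
    for l t :: real
  \<comment> \<open>The identities hold for \<open>t > 1\<close>, hence eventually, which is all
    that limits at infinity see.\<close>
  have f: "\<forall>\<^sub>F t in at_top. f l t = log_avg s l t - s t" if "1 < l" for l
    using eventually_gt_at_top[of 1]
    by eventually_elim (use that assms(1) in \<open>simp only: f_def forward_mean_eq\<close>)
  have g: "\<forall>\<^sub>F t in at_top. g l t = s t - log_avg s l t" if "0 < l" "l < 1" for l
    using eventually_gt_at_top[of 1]
    by eventually_elim (use that assms(1) in \<open>simp only: g_def backward_mean_eq\<close>)
  have right: "\<forall>\<^sub>F l in at_right 1. 1 < (l::real)"
    by (rule eventually_at_right_less)
  have left: "\<forall>\<^sub>F l in at_left 1. 0 < l \<and> l < (1::real)"
    using eventually_at_left_real[of 0 1] by simp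
  have "(s \<longlongrightarrow> A) at_top \<longleftrightarrow>
     Limsup (at_right 1) (\<lambda>l. Liminf at_top (\<lambda>t. ereal (f l t))) \<ge> 0
   \<and> Limsup (at_left 1) (\<lambda>l. Liminf at_top (\<lambda>t. ereal (g l t))) \<ge> 0" (is "_ \<longleftrightarrow> ?R \<and> ?L")
  proof (intro iffI conjI)
    assume s: "(s \<longlongrightarrow> A) at_top"
    have "(f l \<longlongrightarrow> 0) at_top" if "1 < l" for l
      using tendsto_diff[OF log_avg_tendsto[OF assms(2), of l] s] that
      by (subst tendsto_cong[OF f[OF that]]) simp
    then show ?R
      using right by (subst Limsup_Liminf_eq_0) (auto elim: eventually_mono)
    have "(g l \<longlongrightarrow> 0) at_top" if "0 < l" "l < 1" for l
      using tendsto_diff[OF s log_avg_tendsto[OF assms(2), of l]] that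
      by (subst tendsto_cong[OF g[OF that]]) simp
    then show ?L
      using left by (subst Limsup_Liminf_eq_0) (auto elim: eventually_mono)
  next
    assume RL: "?R \<and> ?L"
    show "(s \<longlongrightarrow> A) at_top"
    proof (rule order_tendstoI)
      fix y assume "y < A"
      \<comment> \<open>The gap is split in two: one \<open>e\<close> is lost in the backward
        condition \<open>s t - log_avg s l t > - e\<close>, the other in
        \<open>log_avg s l t > A - e\<close>.\<close>
      then obtain e where e: "0 < e" "y = A - 2 * e"
        by (intro that[of "(A - y) / 2"]) (simp_all add: field_simps)
      obtain l where l: "0 < l \<and> l < 1" "\<forall>\<^sub>F t in at_top. - e < g l t"
        using Limsup_Liminf_nonneg_obtains[OF conjunct2[OF RL] left e(1)] .
      have "\<forall>\<^sub>F t in at_top. A - e < log_avg s l t"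
        using log_avg_tendsto[OF assms(2), of l] l(1) e(1) by (intro order_tendstoD(1)) auto
      with l(2) g[OF conjunct1[OF l(1)] conjunct2[OF l(1)]]
      show "\<forall>\<^sub>F t in at_top. y < s t"
        by eventually_elim (simp add: e(2))
    next
      fix y assume "A < y"
      \<comment> \<open>Symmetrically, the forward condition gives
        \<open>s t < log_avg s l t + e\<close>, and the average is eventually below
        \<open>A + e\<close>.\<close>
      then obtain e where e: "0 < e" "y = A + 2 * e"
        by (intro that[of "(y - A) / 2"]) (simp_all add: field_simps)
      obtain l where l: "1 < l" "\<forall>\<^sub>F t in at_top. - e < f l t"
        using Limsup_Liminf_nonneg_obtains[OF conjunct1[OF RL] right e(1)] .
      have "\<forall>\<^sub>F t in at_top. log_avg s l t < A + e"
        using log_avg_tendsto[OF assms(2), of l] l(1) e(1) by (intro order_tendstoD(2)) auto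
      with l(2) f[OF l(1)] show "\<forall>\<^sub>F t in at_top. s t < y"
        by eventually_elim (simp add: e(2))
    qed
  qed
  then show ?thesis
    unfolding f_def g_def .
qed

end
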